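(* Let $d\ge 1$ and let $\gamma : t \mapsto \mathcal{N}(\mu_{t}, \Sigma_{t})$ be a geodesic of $\mathbb{G}_{d}$. Then the following quantities do not depend on $t$: $$J_{\mu} = \Sigma_{t}^{-1} \dot{\mu}_{t},\qquad J_{\Sigma} = \Sigma_{t}^{-1} ( \dot{\mu}_{t}\, \mu_{t}^{T}+ \dot{\Sigma}_{t}).$$
   Context: $\mathbb{G}_d$ is the manifold of (nondegenerate) Gaussian distributions $\mathcal N(\mu,\Sigma)$ on $\mathbb{R}^d$, with global coordinates $(\mu,\Sigma)$, $\mu\in\mathbb{R}^d$ (column vector), $\Sigma$ a real symmetric positive definite $d\times d$ matrix. It is equipped with the Fisher metric, for which the squared norm of a tangent vector $(\dot\mu,\dot\Sigma)$ ($\dot\mu\in\mathbb{R}^d$, $\dot\Sigma$ symmetric) at $\mathcal N(\mu,\Sigma)$ is $$\dot\mu^{T}\Sigma^{-1}\dot\mu+\tfrac12\operatorname{tr}(\dot\Sigma\Sigma^{-1}\dot\Sigma\Sigma^{-1}).$$ Geodesics are the usual (constant speed) Riemannian geodesics, i.e. critical curves of the energy functional $\int g(\dot\gamma,\dot\gamma)\,dt$ with fixed endpoints on every compact subinterval. A dot denotes the derivative in $t$. *)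

theory Defs
  imports "HOL-Analysis.Analysis"
begin

definition outer :: "real ^ 'n \<Rightarrow> real ^ 'm \<Rightarrow> real ^ 'm ^ 'n" where
  "outer x y = (\<chi> i j. x $ i * y $ j)"

definition pos_def_matrix :: "real ^ 'd ^ 'd \<Rightarrow> bool" where
  "pos_def_matrix S \<longleftrightarrow> transpose S = S \<and> (\<forall>x. x \<noteq> 0 \<longrightarrow> x \<bullet> (S *v x) > 0)"

text \<open>The manifold of nondegenerate Gaussian distributions, in its global coordinates
  (mean, covariance matrix). It is an open subset of \<open>\<real>\<^sup>d \<times> Sym\<^sub>d\<close>, hence a smooth map into it is
  a smooth map into \<^typ>\<open>(real ^ 'd) \<times> (real ^ 'd ^ 'd)\<close> with values in this set, and the velocity
  of a curve in it automatically has a symmetric second component.\<close>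

type_synonym 'd gaussian = "(real ^ 'd) \<times> (real ^ 'd ^ 'd)"

definition gaussians :: "'d::finite gaussian set" where
  "gaussians = {(m, S). pos_def_matrix S}"

definition fisher_sqnorm :: "'d::finite gaussian \<Rightarrow> 'd gaussian \<Rightarrow> real" where
  "fisher_sqnorm p v =
     (let P = matrix_inv (snd p)
      in fst v \<bullet> (P *v fst v) + 1/2 * trace (snd v ** P ** snd v ** P))"

text \<open>Smoothness of maps between Euclidean spaces: first \<open>C\<^sup>k\<close> and \<open>C\<^sup>\<infinity>\<close> on open sets, then smoothness
  on an arbitrary set as the existence of a smooth extension to a neighbourhood.\<close>

primrec Ck_on :: "nat \<Rightarrow> ('a::euclidean_space \<Rightarrow> 'b::euclidean_space) \<Rightarrow> 'a set \<Rightarrow> bool" where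
  "Ck_on 0 f U \<longleftrightarrow> continuous_on U f"
| "Ck_on (Suc k) f U \<longleftrightarrow>
     (\<forall>x\<in>U. f differentiable (at x)) \<and> (\<forall>v. Ck_on k (\<lambda>x. frechet_derivative f (at x) v) U)"

definition smooth_on :: "'a::euclidean_space set \<Rightarrow> ('a \<Rightarrow> 'b::euclidean_space) \<Rightarrow> bool" where
  "smooth_on X f \<longleftrightarrow>
     (\<exists>U g. open U \<and> X \<subseteq> U \<and> (\<forall>k. Ck_on k g U) \<and> (\<forall>x\<in>X. g x = f x))"

definition energy :: "real \<Rightarrow> real \<Rightarrow> (real \<Rightarrow> 'd::finite gaussian) \<Rightarrow> real" where
  "energy a b c =
     integral {a..b} (\<lambda>t. fisher_sqnorm (c t) (vector_derivative c (at t within {a..b})))"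

definition fixed_endpoint_variation ::
  "real \<Rightarrow> real \<Rightarrow> (real \<Rightarrow> 'd::finite gaussian) \<Rightarrow> real \<Rightarrow> (real \<times> real \<Rightarrow> 'd gaussian) \<Rightarrow> bool" where
  "fixed_endpoint_variation a b c \<epsilon> F \<longleftrightarrow>
     \<epsilon> > 0 \<and>
     smooth_on ({-\<epsilon><..<\<epsilon>} \<times> {a..b}) F \<and>
     F ` ({-\<epsilon><..<\<epsilon>} \<times> {a..b}) \<subseteq> gaussians \<and>
     (\<forall>t\<in>{a..b}. F (0, t) = c t) \<and>
     (\<forall>s\<in>{-\<epsilon><..<\<epsilon>}. F (s, a) = c a \<and> F (s, b) = c b)"

definition energy_critical :: "real \<Rightarrow> real \<Rightarrow> (real \<Rightarrow> 'd::finite gaussian) \<Rightarrow> bool" where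
  "energy_critical a b c \<longleftrightarrow>
     (\<forall>\<epsilon> F. fixed_endpoint_variation a b c \<epsilon> F \<longrightarrow>
        ((\<lambda>s. energy a b (\<lambda>t. F (s, t))) has_real_derivative 0) (at 0))"

text \<open>The parameter interval may be open, closed or half-open, bounded or not; at an endpoint
  belonging to it, derivatives are one-sided.\<close>

definition geodesic_on :: "real set \<Rightarrow> (real \<Rightarrow> 'd::finite gaussian) \<Rightarrow> bool" where
  "geodesic_on I c \<longleftrightarrow>
     is_interval I \<and> smooth_on I c \<and> c ` I \<subseteq> gaussians \<and>
     (\<forall>a b. a < b \<longrightarrow> {a..b} \<subseteq> I \<longrightarrow> energy_critical a b c)"

definition J_mu :: "real set \<Rightarrow> (real \<Rightarrow> real ^ 'd) \<Rightarrow> (real \<Rightarrow> real ^ 'd ^ 'd) \<Rightarrow> real \<Rightarrow> real ^ 'd" where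
  "J_mu I \<mu> \<Sigma> t = matrix_inv (\<Sigma> t) *v vector_derivative \<mu> (at t within I)"

definition J_Sigma ::
  "real set \<Rightarrow> (real \<Rightarrow> real ^ 'd) \<Rightarrow> (real \<Rightarrow> real ^ 'd ^ 'd) \<Rightarrow> real \<Rightarrow> real ^ 'd ^ 'd" where
  "J_Sigma I \<mu> \<Sigma> t =
     matrix_inv (\<Sigma> t) **
       (outer (vector_derivative \<mu> (at t within I)) (\<mu> t) + vector_derivative \<Sigma> (at t within I))"

end

theory Submission
  imports Defs
begin

text \<open>
  The two quantities are the momenta that Noether's theorem attaches to the symmetries of the Fisher metric.
  The affine group acts on Gaussians by \<open>(m, S) \<mapsto> (A m + b, A S A\<^sup>T)\<close>, and this action is isometric
  (\<open>fisher_sqnorm_pushforward\<close>). The inner product of the velocity of a curve with the generator of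
  translations along \<open>v\<close> is \<open>v \<bullet> J\<^sub>\<mu>\<close>, and its inner product with the generator belonging to the matrix \<open>x y\<^sup>T\<close>
  is \<open>x \<bullet> J\<^sub>\<Sigma> y\<close> (\<open>fisher_form_affine_field\<close>). It is therefore enough to show that these inner products are
  constant along a critical curve of the energy.

  Noether's argument gives this without the geodesic equation. Move the curve by
  the one-parameter family of affine maps with the time-dependent parameter \<open>s \<phi>(t)\<close>, where \<open>\<phi>\<close> vanishes at both
  ends of the time interval. Because the action is isometric, only the time derivative of the
  parameter affects the energy density, which becomes the squared norm of \<open>\<gamma>' + r K\<close> with \<open>K\<close> the
  generator and \<open>r = s \<phi>' + O(s\<^sup>2)\<close>. The first variation is \<open>2 \<integral> \<phi>' \<langle>K, \<gamma>'\<rangle> dt\<close>. It vanishes at a critical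
  curve (\<open>energy_critical_weak_conservation\<close>), and since \<open>\<phi>\<close> ranges over all
  polynomials with the required zeros, the inner product \<open>\<langle>K, \<gamma>'\<rangle>\<close> takes equal values at both ends
  (\<open>du_Bois_Reymond_polynomial\<close>).

  Two choices keep the analysis elementary. The generators are affine maps \<open>z \<mapsto> (y \<bullet> z + w) x\<close>, which
  include the translations and whose linear parts span all matrices; the inverse of
  \<open>1 + c x y\<^sup>T\<close> is explicit. The cutoffs are polynomials, so
  that the variation is a polynomial expression in the curve, \<open>s\<close> and \<open>t\<close>, and its smoothness follows from a small calculus of
  \<open>C\<^sup>k\<close> maps (sums, bilinear products, linear substitutions).
\<close>

section \<open>Calculus of \<open>C\<^sup>k\<close> maps\<close>

text \<open>On an open set the Frechet derivative at a point depends only on the values nearby, so the class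
  is insensitive to the values outside \<open>U\<close>. All the derivative computations below rely on this, since
  they determine \<^const>\<open>frechet_derivative\<close> only at the points of \<open>U\<close>.\<close>

lemma Ck_on_cong:
  assumes "open U" "\<And>x. x \<in> U \<Longrightarrow> f x = g x" "Ck_on k f U"
  shows "Ck_on k g U"
  using assms(2,3)
proof (induction k arbitrary: f g)
  case 0
  then show ?case
    using continuous_on_cong[of U U f g] by simp
next
  case (Suc k)
  have g: "(g has_derivative frechet_derivative f (at x)) (at x)" if "x \<in> U" for x
    using Suc.prems(2) that
    by (intro has_derivative_transform_within_open[OF _ assms(1) that Suc.prems(1)])
      (auto simp: frechet_derivative_works)
  have eq: "frechet_derivative f (at x) = frechet_derivative g (at x)" if "x \<in> U" for x
    by (rule frechet_derivative_at[OF g[OF that]])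
  have "Ck_on k (\<lambda>x. frechet_derivative g (at x) v) U" for v
    by (rule Suc.IH[of "\<lambda>x. frechet_derivative f (at x) v"]) (use Suc.prems(2) in \<open>simp_all add: eq\<close>)
  with g show ?case
    by (auto simp: differentiable_def)
qed

text \<open>The working introduction rule: any explicit formula for the derivative that is \<open>C\<^sup>k\<close> in the base
  point will do, because derivatives are unique.\<close>

lemma Ck_on_Suc_derivI:
  assumes "open U" "\<And>x. x \<in> U \<Longrightarrow> (f has_derivative D x) (at x)" "\<And>v. Ck_on k (\<lambda>x. D x v) U"
  shows "Ck_on (Suc k) f U"
proof -
  have eq: "D x = frechet_derivative f (at x)" if "x \<in> U" for x
    by (rule frechet_derivative_at[OF assms(2)[OF that]])
  have "Ck_on k (\<lambda>x. frechet_derivative f (at x) v) U" for v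
    by (rule Ck_on_cong[OF assms(1) _ assms(3)[of v]]) (simp add: eq)
  then show ?thesis
    using assms(2) by (auto simp: differentiable_def)
qed

lemma Ck_on_Suc_has_derivative:
  "Ck_on (Suc k) f U \<Longrightarrow> x \<in> U \<Longrightarrow> (f has_derivative frechet_derivative f (at x)) (at x)"
  by (simp add: frechet_derivative_works)

lemma Ck_on_Suc_imp: "Ck_on (Suc k) f U \<Longrightarrow> Ck_on k f U"
proof (induction k arbitrary: f)
  case 0
  then show ?case
    by (auto intro!: continuous_at_imp_continuous_on differentiable_imp_continuous_within)
next
  case (Suc k)
  then show ?case
    using Ck_on.simps(2) by blast
qed

lemma Ck_on_const: "Ck_on k (\<lambda>x. c) U"
  by (induction k arbitrary: c) auto

lemma Ck_on_linear: 
  assumes "bounded_linear L" "open U"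
  shows "Ck_on k L U"
proof (cases k)
  case 0
  then show ?thesis
    using assms by (simp add: linear_continuous_on)
next
  case (Suc l)
  show ?thesis unfolding Suc
    by (rule Ck_on_Suc_derivI[of _ _ "\<lambda>x. L"])
      (auto intro: assms bounded_linear_imp_has_derivative Ck_on_const)
qed

lemma Ck_on_add:
  assumes "open U" "Ck_on k f U" "Ck_on k g U"
  shows "Ck_on k (\<lambda>x. f x + g x) U"
  using assms(2,3)
proof (induction k arbitrary: f g)
  case 0
  then show ?case by (auto intro: continuous_intros)
next
  case (Suc k)
  show ?case
  proof (rule Ck_on_Suc_derivI[OF assms(1)])
    show "((\<lambda>x. f x + g x) has_derivative 
        (\<lambda>v. frechet_derivative f (at x) v + frechet_derivative g (at x) v)) (at x)"
      if "x \<in> U" for x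
      using that Suc.prems by (intro has_derivative_add Ck_on_Suc_has_derivative)
    show "Ck_on k (\<lambda>x. frechet_derivative f (at x) v + frechet_derivative g (at x) v) U" for v
      by (rule Suc.IH) (use Suc.prems in simp_all)
  qed
qed

lemma Ck_on_Pair:
  assumes "open U" "Ck_on k f U" "Ck_on k g U"
  shows "Ck_on k (\<lambda>x. (f x, g x)) U"
  using assms(2,3)
proof (induction k arbitrary: f g)
  case 0
  then show ?case by (auto intro: continuous_intros)
next
  case (Suc k)
  show ?case
  proof (rule Ck_on_Suc_derivI[OF assms(1)])
    show "((\<lambda>x. (f x, g x)) has_derivative 
        (\<lambda>v. (frechet_derivative f (at x) v, frechet_derivative g (at x) v))) (at x)"
      if "x \<in> U" for x
      using that Suc.prems by (intro has_derivative_Pair Ck_on_Suc_has_derivative)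
    show "Ck_on k (\<lambda>x. (frechet_derivative f (at x) v, frechet_derivative g (at x) v)) U" for v
      by (rule Suc.IH) (use Suc.prems in simp_all)
  qed
qed

text \<open>The product rule \<open>h(f, g)' = h(f, g') + h(f', g)\<close> reproduces the same shape one class lower, so the
  induction hypothesis is needed for arbitrary factors. One lemma covers the products of
  scalars and of matrices.\<close>

lemma Ck_on_bilinear:
  assumes "bounded_bilinear h" "open U" "Ck_on k f U" "Ck_on k g U"
  shows "Ck_on k (\<lambda>x. h (f x) (g x)) U"
  using assms(3,4)
proof (induction k arbitrary: f g)
  case 0
  then show ?case
    by (auto intro: bounded_bilinear.continuous_on[OF assms(1)])
next
  case (Suc k)
  have "Ck_on k f U" "Ck_on k g U"
    using Suc.prems by (auto intro: Ck_on_Suc_imp)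
  note lower = this
  show ?case
  proof (rule Ck_on_Suc_derivI[OF assms(2)])
    show "((\<lambda>x. h (f x) (g x)) has_derivative 
        (\<lambda>v. h (f x) (frechet_derivative g (at x) v) + h (frechet_derivative f (at x) v) (g x))) (at x)"
      if "x \<in> U" for x
      using that Suc.prems by (intro bounded_bilinear.FDERIV[OF assms(1)] Ck_on_Suc_has_derivative)
    show "Ck_on k (\<lambda>x. h (f x) (frechet_derivative g (at x) v) + h (frechet_derivative f (at x) v) (g x)) U" 
      for v
    proof (rule Ck_on_add[OF assms(2)])
      show "Ck_on k (\<lambda>x. h (f x) (frechet_derivative g (at x) v)) U"
        using Suc.prems(2) by (intro Suc.IH lower) simp
      show "Ck_on k (\<lambda>x. h (frechet_derivative f (at x) v) (g x)) U"
        using Suc.prems(1) by (intro Suc.IH lower) simp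
    qed
  qed
qed

lemma Ck_on_linear_compose:
  assumes "bounded_linear L" "open U" "Ck_on k f U"
  shows "Ck_on k (\<lambda>x. L (f x)) U"
  using assms(3)
proof (induction k arbitrary: f)
  case 0
  then show ?case
    by (auto intro: bounded_linear.continuous_on[OF assms(1)])
next
  case (Suc k)
  show ?case
  proof (rule Ck_on_Suc_derivI[OF assms(2)])
    show "((\<lambda>x. L (f x)) has_derivative (\<lambda>v. L (frechet_derivative f (at x) v))) (at x)"
      if "x \<in> U" for x
      using that Suc.prems by (intro bounded_linear.has_derivative[OF assms(1)] Ck_on_Suc_has_derivative)
    show "Ck_on k (\<lambda>x. L (frechet_derivative f (at x) v)) U" for v
      by (rule Suc.IH) (use Suc.prems in simp_all)
  qed
qed

text \<open>Used with the projection of the \<open>(s, t)\<close>-plane to the time axis, where it turns a smooth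
  curve into a smooth map of both parameters.\<close>

lemma Ck_on_compose_linear:
  assumes "bounded_linear L" "open V" "Ck_on k f V"
  shows "Ck_on k (\<lambda>x. f (L x)) (L -` V)"
  using assms(3)
proof (induction k arbitrary: f)
  case 0
  then show ?case
    using continuous_on_compose2[of V f "L -` V" L] linear_continuous_on[OF assms(1)] by auto
next
  case (Suc k)
  show ?case
  proof (rule Ck_on_Suc_derivI)
    show "open (L -` V)"
      by (intro open_vimage assms(2) linear_continuous_on assms(1))
    show "((\<lambda>x. f (L x)) has_derivative (\<lambda>v. frechet_derivative f (at (L x)) (L v))) (at x)"
      if "x \<in> L -` V" for x
      using that Suc.prems
      by (intro has_derivative_compose[OF bounded_linear_imp_has_derivative[OF assms(1)]] 
          Ck_on_Suc_has_derivative) auto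
    show "Ck_on k (\<lambda>x. frechet_derivative f (at (L x)) (L v)) (L -` V)" for v
      by (rule Suc.IH) (use Suc.prems in simp)
  qed
qed

lemma Ck_on_real_polynomial_function:
  assumes "real_polynomial_function p" "open U"
  shows "Ck_on k p U"
  using assms(1)
proof induction
  case (linear f)
  then show ?case by (rule Ck_on_linear[OF _ assms(2)])
next
  case (const c)
  show ?case by (rule Ck_on_const)
next
  case (add f g)
  then show ?case by (intro Ck_on_add assms(2))
next
  case (mult f g)
  then show ?case
    by (intro Ck_on_bilinear[OF bounded_bilinear_mult assms(2)])
qed

lemma Ck_on_Suc_vector_derivative:
  fixes f :: "real \<Rightarrow> 'b::euclidean_space"
  assumes "Ck_on (Suc k) f U" "open U"
  obtains f' where "\<And>t. t \<in> U \<Longrightarrow> (f has_vector_derivative f' t) (at t)" "Ck_on k f' U"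
proof
  show "(f has_vector_derivative frechet_derivative f (at t) 1) (at t)" if "t \<in> U" for t
  proof -
    have D: "(f has_derivative frechet_derivative f (at t)) (at t)"
      using assms(1) that by (rule Ck_on_Suc_has_derivative)
    have "frechet_derivative f (at t) x = x *\<^sub>R frechet_derivative f (at t) 1" for x
      using linear_scale[OF has_derivative_linear[OF D], of x 1] by (simp only: real_scaleR_def mult_1_right)
    then have "(\<lambda>x. x *\<^sub>R frechet_derivative f (at t) 1) = frechet_derivative f (at t)"
      by (intro ext) (rule sym)
    with D show ?thesis
      unfolding has_vector_derivative_def by (simp only:)
  qed
  show "Ck_on k (\<lambda>t. frechet_derivative f (at t) 1) U"
    using assms by simp
qed

section \<open>The lemma of du Bois-Reymond with polynomial test functions\<close>

lemma real_polynomial_function_antiderivative: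
  fixes p :: "real \<Rightarrow> real"
  assumes "real_polynomial_function p"
  obtains P where "real_polynomial_function P" "\<And>t. (P has_real_derivative p t) (at t)" "P a = 0"
proof -
  obtain c n where p: "p = (\<lambda>x. \<Sum>i\<le>n. c i * x ^ i)"
    using assms real_polynomial_function_imp_sum by blast
  define Q :: "real \<Rightarrow> real" where "Q = (\<lambda>x. \<Sum>i\<le>n. c i * (x ^ Suc i / real (Suc i)))"
  have D: "(Q has_real_derivative p t) (at t)" for t
    unfolding p Q_def
    by (rule derivative_eq_intros refl | simp add: field_simps del: of_nat_Suc power_Suc)+
  have "real_polynomial_function Q"
    unfolding Q_def by (intro real_polynomial_function_sum real_polynomial_function_divide 
        real_polynomial_function.intros real_polynomial_function_power bounded_linear_ident finite_atMost)
  then show ?thesis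
    by (intro that[of "\<lambda>t. Q t - Q a"]) (auto intro!: derivative_eq_intros D)
qed

text \<open>Let \<open>h\<close> be \<open>g\<close> minus its mean over the interval. Every polynomial minus its mean is the derivative of a
  polynomial that vanishes at both ends, so the hypothesis makes \<open>h\<close> orthogonal to all polynomials.
  These are uniformly dense, so \<open>h\<close> is orthogonal to itself and vanishes. Polynomial test functions
  suffice for continuous \<open>g\<close>, and they are smooth for trivial reasons, which keeps the variations built from
  them smooth as well; the classical test function, a primitive of \<open>h\<close> itself, would require
  the smoothness of \<open>g\<close>.\<close>

lemma du_Bois_Reymond_polynomial:
  fixes g :: "real \<Rightarrow> real"
  assumes ab: "a < b" and cont: "continuous_on {a..b} g"
    and weak: "\<And>\<phi> \<phi>'. \<lbrakk>real_polynomial_function \<phi>; real_polynomial_function \<phi>'; 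
      \<And>t. (\<phi> has_real_derivative \<phi>' t) (at t); \<phi> a = 0; \<phi> b = 0\<rbrakk>
      \<Longrightarrow> integral {a..b} (\<lambda>t. \<phi>' t * g t) = 0"
  shows "g a = g b"
proof -
  define m where "m = integral {a..b} g / (b - a)"
  define h where "h t = g t - m" for t
  have conth: "continuous_on {a..b} h"
    unfolding h_def by (intro continuous_intros cont)
  have h0: "integral {a..b} h = 0"
    unfolding h_def using ab
    by (subst integral_diff) (auto simp: m_def intro: integrable_continuous_real cont)
  have ortho: "integral {a..b} (\<lambda>t. q t * h t) = 0" if q: "real_polynomial_function q" for q
  proof -
    have qc: "continuous_on {a..b} q"
      using q continuous_on_polymonial_function real_polynomial_function_eq by blast
    define k where "k = integral {a..b} q / (b - a)"
    have qk: "real_polynomial_function (\<lambda>t. q t - k)"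
      by (intro real_polynomial_function_diff q real_polynomial_function.intros(2))
    obtain P where P: "real_polynomial_function P" "\<And>t. (P has_real_derivative q t - k) (at t)" "P a = 0"
      using real_polynomial_function_antiderivative[OF qk] by blast
    have "((\<lambda>t. q t - k) has_integral P b - P a) {a..b}"
      using ab P(2) by (intro fundamental_theorem_of_calculus)
        (auto simp: has_real_derivative_iff_has_vector_derivative[symmetric] intro: DERIV_subset)
    then have ftc: "((\<lambda>t. q t - k) has_integral P b) {a..b}"
      by (simp add: P(3))
    have i0: "((\<lambda>t. q t - k) has_integral 0) {a..b}"
      using has_integral_diff[OF integrable_integral[OF integrable_continuous_real[OF qc]] 
        has_integral_const_real[of k a b]] ab by (simp add: k_def)
    have "P b = 0"
      by (rule has_integral_unique[OF ftc i0])
    then have "integral {a..b} (\<lambda>t. (q t - k) * g t) = 0"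
      by (rule weak[OF P(1) qk P(2,3)])
    moreover have "(\<lambda>t. (q t - k) * g t) integrable_on {a..b}"
      by (intro integrable_continuous_real continuous_intros qc cont)
    ultimately have i1: "((\<lambda>t. (q t - k) * g t) has_integral 0) {a..b}"
      by (simp add: has_integral_integrable_integral)
    have i2: "(h has_integral 0) {a..b}"
      using h0 integrable_integral[OF integrable_continuous_real[OF conth]] by simp
    have "((\<lambda>t. (q t - k) * g t - (q t - k) * m + k * h t) has_integral 0 - 0 * m + k * 0) {a..b}"
      by (intro has_integral_add has_integral_diff has_integral_mult_left has_integral_mult_right i0 i1 i2)
    moreover have "(q t - k) * g t - (q t - k) * m + k * h t = q t * h t" for t
      by (simp add: h_def algebra_simps)
    ultimately show ?thesis
      by (simp add: integral_unique)
  qed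
  \<comment> \<open>Weierstrass: a polynomial within \<open>e / (K + 1)\<close> of \<open>h\<close> changes the integral of \<open>h * h\<close> by at most \<open>e\<close>.\<close>
  define K where "K = integral {a..b} (\<lambda>t. \<bar>h t\<bar>)"
  have K: "K \<ge> 0"
    unfolding K_def by (intro integral_nonneg integrable_continuous_real continuous_intros conth) auto
  have "integral {a..b} (\<lambda>t. h t * h t) \<le> 0 + e" if "e > 0" for e
  proof -
    have "e / (K + 1) > 0" using that K by simp
    then obtain q where q: "real_polynomial_function q" "\<And>x. x \<in> {a..b} \<Longrightarrow> \<bar>h x - q x\<bar> < e / (K + 1)"
      using Stone_Weierstrass_real_polynomial_function[OF compact_Icc conth] by blast
    have qc: "continuous_on {a..b} q"
      using q(1) continuous_on_polymonial_function real_polynomial_function_eq by blast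
    have "integral {a..b} (\<lambda>t. h t * h t) = integral {a..b} (\<lambda>t. h t * h t) - integral {a..b} (\<lambda>t. q t * h t)"
      using ortho[OF q(1)] by simp
    also have "\<dots> = integral {a..b} (\<lambda>t. h t * h t - q t * h t)"
      by (subst integral_diff) (intro integrable_continuous_real continuous_intros qc conth refl)+
    also have "\<dots> \<le> integral {a..b} (\<lambda>t. e / (K + 1) * \<bar>h t\<bar>)"
    proof (rule integral_le)
      fix t assume t: "t \<in> {a..b}"
      have "h t * h t - q t * h t \<le> \<bar>h t - q t\<bar> * \<bar>h t\<bar>"
        by (metis abs_ge_self abs_mult left_diff_distrib)
      also have "\<dots> \<le> e / (K + 1) * \<bar>h t\<bar>"
        using q(2)[OF t] by (intro mult_right_mono) auto
      finally show "h t * h t - q t * h t \<le> e / (K + 1) * \<bar>h t\<bar>" .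
    qed (intro integrable_continuous_real continuous_intros qc conth)+
    also have "\<dots> = e / (K + 1) * K" by (simp add: K_def)
    also have "\<dots> \<le> e" using K that by (simp add: field_simps)
    finally show ?thesis by simp
  qed
  then have "integral {a..b} (\<lambda>t. h t * h t) \<le> 0"
    by (rule field_le_epsilon)
  moreover have "integral {a..b} (\<lambda>t. h t * h t) \<ge> 0"
    by (intro integral_nonneg integrable_continuous_real continuous_intros conth) auto
  ultimately have "integral {a..b} (\<lambda>t. h t * h t) = 0" by simp
  moreover have "continuous_on {a..b} (\<lambda>t. h t * h t)"
    by (intro continuous_on_mult conth)
  ultimately have "h t * h t = 0" if "t \<in> {a..b}" for t
    using integral_eq_0_iff[of a b "\<lambda>t. h t * h t"] ab that by simp
  from this[of a] this[of b] show ?thesis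
    using ab by (simp add: h_def)
qed

section \<open>Matrix inverses, rank-one matrices and continuity\<close>

lemma matrix_inv_right_left:
  fixes A :: "'a::semiring_1^'n^'m"
  assumes "invertible A"
  shows "A ** matrix_inv A = mat 1" "matrix_inv A ** A = mat 1"
proof -
  have "A ** matrix_inv A = mat 1 \<and> matrix_inv A ** A = mat 1"
    using assms unfolding matrix_inv_def invertible_def by (rule someI_ex)
  then show "A ** matrix_inv A = mat 1" "matrix_inv A ** A = mat 1" by auto
qed

lemma matrix_inv_eqI:
  fixes A :: "real^'n^'n"
  assumes "A ** B = mat 1"
  shows "matrix_inv A = B"
proof -
  have "invertible A"
    using assms invertible_right_inverse by blast
  then have "matrix_inv A ** A = mat 1" by (rule matrix_inv_right_left)
  with assms show ?thesis
    by (metis matrix_mul_assoc matrix_mul_lid matrix_mul_rid)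
qed

lemma matrix_mult_add_left: "(A + B) ** (C :: real^'p^'n) = A ** C + B ** C"
  by (vector matrix_matrix_mult_def sum.distrib[symmetric] field_simps)

lemma bounded_bilinear_matrix_matrix_mult:
  "bounded_bilinear ((**) :: real^'n^'m \<Rightarrow> real^'p^'n \<Rightarrow> real^'p^'m)"
  unfolding bilinear_conv_bounded_bilinear[symmetric] bilinear_def linear_iff
  by (simp add: matrix_add_ldistrib matrix_mult_add_left matrix_scalar_ac scalar_matrix_assoc)

lemma bounded_bilinear_matrix_vector_mult:
  "bounded_bilinear ((*v) :: real^'n^'m \<Rightarrow> real^'n \<Rightarrow> real^'m)"
  unfolding bilinear_conv_bounded_bilinear[symmetric] bilinear_def linear_iff
  by (simp add: matrix_vector_mult_add_rdistrib matrix_vector_right_distrib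
      matrix_vector_mult_scaleR scaleR_matrix_vector_assoc)

lemma bounded_linear_transpose: "bounded_linear (transpose :: real^'n^'m \<Rightarrow> real^'m^'n)"
  unfolding linear_conv_bounded_linear[symmetric] linear_iff
  by (simp add: transpose_def vec_eq_iff)

lemma bounded_linear_trace: "bounded_linear (trace :: real^'n^'n \<Rightarrow> real)"
  unfolding linear_conv_bounded_linear[symmetric] linear_iff
  by (simp add: trace_def sum.distrib sum_distrib_left)

lemma inner_transpose_matrix_vector:
  fixes A :: "real^'n^'m"
  shows "x \<bullet> (transpose A *v y) = (A *v x) \<bullet> y"
  by (metis dot_lmul_matrix inner_commute transpose_matrix_vector)

text \<open>By Cramer's rule the entries of the inverse are quotients of determinants, which are polynomial
  in the entries.\<close>

lemma continuous_on_matrix_inv: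
  fixes S :: "'a::topological_space \<Rightarrow> real^'n^'n"
  assumes S: "continuous_on T S" and inv: "\<And>t. t \<in> T \<Longrightarrow> invertible (S t)"
  shows "continuous_on T (\<lambda>t. matrix_inv (S t))"
proof -
  define C where "C t k j = (\<chi> i l. if l = k then axis j 1 $ i else S t $ i $ l)" for t and k j :: 'n
  have contS: "continuous_on T (\<lambda>t. S t $ i $ l)" for i l
    by (intro continuous_intros S)
  have contC: "continuous_on T (\<lambda>t. C t k j $ i $ l)" for k j i l
    using contS by (cases "l = k") (simp_all add: C_def)
  have contdet: "continuous_on T (\<lambda>t. det (M t))"
    if "\<And>i l. continuous_on T (\<lambda>t. M t $ i $ l)" for M :: "'a \<Rightarrow> real^'n^'n"
    unfolding det_def by (intro continuous_intros that)
  have det: "det (S t) \<noteq> 0" if "t \<in> T" for t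
    using inv[OF that] invertible_det_nz by blast
  have entry: "matrix_inv (S t) $ k $ j = det (C t k j) / det (S t)" if "t \<in> T" for t k j
  proof -
    have "S t *v (matrix_inv (S t) *v axis j 1) = axis j 1"
      using matrix_inv_right_left(1)[OF inv[OF that]] by (simp add: matrix_vector_mul_assoc)
    then have "matrix_inv (S t) *v axis j 1 = (\<chi> k. det (C t k j) / det (S t))"
      unfolding C_def using cramer[OF det[OF that]] by blast
    moreover have "(matrix_inv (S t) *v axis j 1) $ k = matrix_inv (S t) $ k $ j"
      by (simp add: matrix_vector_mul_component inner_axis)
    ultimately show ?thesis by simp
  qed
  have "continuous_on T (\<lambda>t. \<chi> k j. det (C t k j) / det (S t))"
    by (intro continuous_intros contdet contC contS det ballI)
  moreover have "matrix_inv (S t) = (\<chi> k j. det (C t k j) / det (S t))" if "t \<in> T" for t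
    using entry[OF that] by (simp add: vec_eq_iff)
  ultimately show ?thesis
    using continuous_on_cong by (metis (no_types, lifting))
qed

lemma outer_mult_vector: "outer x y *v z = (y \<bullet> z) *\<^sub>R x"
  by (simp add: outer_def matrix_vector_mult_def vec_eq_iff inner_vec_def sum_distrib_right
      sum_distrib_left mult_ac)

lemma transpose_outer: "transpose (outer x y) = outer y x"
  by (simp add: outer_def transpose_def vec_eq_iff)

lemma matrix_mult_outer: "M ** outer x y = outer (M *v x) y"
  by (simp add: outer_def matrix_vector_mult_def matrix_matrix_mult_def vec_eq_iff sum_distrib_left mult_ac)

lemma outer_mult_matrix: "outer x y ** M = outer x (transpose M *v y)"
  by (simp add: outer_def matrix_vector_mult_def matrix_matrix_mult_def vec_eq_iff transpose_def
      sum_distrib_left mult_ac del: transpose_matrix_vector)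

lemma outer_scaleR_left: "outer (c *\<^sub>R x) y = c *\<^sub>R outer x y"
  by (simp add: outer_def vec_eq_iff)

lemma trace_outer: "trace (outer x y) = x \<bullet> y"
  by (simp add: outer_def trace_def inner_vec_def)

section \<open>The Fisher metric and its affine invariance\<close>

lemma pos_def_invertible:
  assumes "pos_def_matrix S"
  shows "invertible S"
proof -
  have "x = 0" if "S *v x = 0" for x
    using assms that unfolding pos_def_matrix_def by (metis inner_zero_right less_irrefl)
  then show ?thesis
    using invertible_left_inverse matrix_left_invertible_ker by blast
qed

lemma transpose_matrix_inv_pos_def:
  assumes "pos_def_matrix S"
  shows "transpose (matrix_inv S) = matrix_inv S"
proof -
  have "transpose S = S"
    using assms by (simp add: pos_def_matrix_def)
  moreover have "matrix_inv S ** S = mat 1"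
    using pos_def_invertible[OF assms] by (rule matrix_inv_right_left)
  ultimately have "S ** transpose (matrix_inv S) = mat 1"
    by (metis matrix_transpose_mul transpose_mat)
  then show ?thesis
    by (rule matrix_inv_eqI[symmetric])
qed

lemma pos_def_congruence:
  fixes S A :: "real^'d^'d"
  assumes S: "pos_def_matrix S" and A: "invertible A"
  shows "pos_def_matrix (A ** S ** transpose A)"
  unfolding pos_def_matrix_def
proof (intro conjI allI impI)
  show "transpose (A ** S ** transpose A) = A ** S ** transpose A"
    using S by (simp add: matrix_transpose_mul pos_def_matrix_def matrix_mul_assoc)
  fix x :: "real^'d" assume "x \<noteq> 0"
  then have "transpose A *v x \<noteq> 0"
    using inj_matrix_vector_mult[OF transpose_invertible[OF A]] 
    by (metis injD matrix_vector_mult_0_right)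
  moreover have "x \<bullet> ((A ** S ** transpose A) *v x) = (transpose A *v x) \<bullet> (S *v (transpose A *v x))"
    using inner_transpose_matrix_vector[of x "transpose A" "S *v (transpose A *v x)"]
    by (simp only: transpose_transpose matrix_vector_mul_assoc matrix_mul_assoc)
  ultimately show "x \<bullet> ((A ** S ** transpose A) *v x) > 0"
    using S unfolding pos_def_matrix_def by metis
qed

text \<open>The inner product obtained from the squared norm by polarization.\<close>

definition fisher_form :: "'d::finite gaussian \<Rightarrow> 'd gaussian \<Rightarrow> 'd gaussian \<Rightarrow> real" where
  "fisher_form p u v = (let P = matrix_inv (snd p)
    in fst u \<bullet> (P *v fst v) + 1/2 * trace (snd u ** P ** snd v ** P))"

lemma fisher_sqnorm_eq_form: "fisher_sqnorm p u = fisher_form p u u"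
  by (simp add: fisher_sqnorm_def fisher_form_def)

lemma fisher_sqnorm_add_scaleR:
  assumes "pos_def_matrix (snd p)"
  shows "fisher_sqnorm p (u + r *\<^sub>R v) = 
    fisher_sqnorm p u + 2 * r * fisher_form p v u + r\<^sup>2 * fisher_sqnorm p v"
proof -
  define P where "P = matrix_inv (snd p)"
  have sym: "transpose P = P"
    unfolding P_def by (rule transpose_matrix_inv_pos_def[OF assms])
  have 1: "fst u \<bullet> (P *v fst v) = fst v \<bullet> (P *v fst u)"
    using inner_transpose_matrix_vector[of "fst u" P "fst v"] unfolding sym 
    by (simp add: inner_commute)
  have 2: "trace (snd u ** P ** snd v ** P) = trace (snd v ** P ** snd u ** P)"
    using trace_mul_sym[of "snd u ** P" "snd v ** P"] by (simp add: matrix_mul_assoc)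
  interpret mm: bounded_bilinear "(**) :: real^'a^'a \<Rightarrow> real^'a^'a \<Rightarrow> real^'a^'a"
    by (rule bounded_bilinear_matrix_matrix_mult)
  interpret mv: bounded_bilinear "(*v) :: real^'a^'a \<Rightarrow> real^'a \<Rightarrow> real^'a"
    by (rule bounded_bilinear_matrix_vector_mult)
  interpret tr: bounded_linear "trace :: real^'a^'a \<Rightarrow> real"
    by (rule bounded_linear_trace)
  show ?thesis
    unfolding fisher_sqnorm_eq_form fisher_form_def Let_def P_def[symmetric]
    by (simp add: mm.add_left mm.add_right mm.scaleR_left mm.scaleR_right
        mv.add_right mv.scaleR_right tr.add tr.scale inner_add_left inner_add_right 1 2
        algebra_simps power2_eq_square)
qed

definition pushforward :: "real^'d^'d \<Rightarrow> 'd::finite gaussian \<Rightarrow> 'd gaussian" where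
  "pushforward A u = (A *v fst u, A ** snd u ** transpose A)"

text \<open>The linear map \<open>x \<mapsto> A x\<close> carries \<open>N(m, S)\<close> to a Gaussian with covariance \<open>A S A\<^sup>T\<close> and acts on
  tangent vectors by the pushforward; the metric depends on the covariance alone, hence the arbitrary \<open>m\<close> and \<open>n\<close>. In the
  formula, the factors \<open>A\<close> cancel against those of the inverse \<open>A\<^bsup>-T\<^esup> S\<^bsup>-1\<^esup> A\<^bsup>-1\<^esup>\<close>, in the trace after
  a cyclic permutation.\<close>

lemma fisher_sqnorm_pushforward:
  assumes A: "invertible A" and S: "invertible S"
  shows "fisher_sqnorm (n, A ** S ** transpose A) (pushforward A u) = fisher_sqnorm (m, S) u"
proof -
  define P Q where "P = matrix_inv S" and "Q = matrix_inv A"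
  have PS: "S ** P = mat 1" unfolding P_def by (rule matrix_inv_right_left(1)[OF S])
  have QA: "A ** Q = mat 1" "Q ** A = mat 1" unfolding Q_def by (rule matrix_inv_right_left[OF A])+
  have AQt: "transpose A ** transpose Q = mat 1"
    using QA(2) by (metis matrix_transpose_mul transpose_mat)
  have cancel: "X ** transpose A ** transpose Q = X" "X ** A ** Q = X" "X ** Q ** A = X" "X ** S ** P = X"
    for X :: "real^'a^'a"
    using AQt QA PS by (simp_all add: matrix_mul_assoc[symmetric])
  have inv: "matrix_inv (A ** S ** transpose A) = transpose Q ** P ** Q"
    by (rule matrix_inv_eqI) (simp add: matrix_mul_assoc cancel QA)
  have "(A *v fst u) \<bullet> ((transpose Q ** P ** Q) *v (A *v fst u)) 
      = (A *v fst u) \<bullet> (transpose Q *v ((P ** Q ** A) *v fst u))"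
    by (simp add: matrix_vector_mul_assoc matrix_mul_assoc del: transpose_matrix_vector)
  also have "\<dots> = fst u \<bullet> (P *v fst u)"
    unfolding inner_transpose_matrix_vector by (simp add: matrix_vector_mul_assoc cancel QA)
  finally have 1: "(A *v fst u) \<bullet> ((transpose Q ** P ** Q) *v (A *v fst u)) = fst u \<bullet> (P *v fst u)" .
  have "trace ((A ** snd u ** transpose A) ** (transpose Q ** P ** Q) ** (A ** snd u ** transpose A)
      ** (transpose Q ** P ** Q)) = trace (A ** (snd u ** P ** snd u ** P ** Q))"
    by (simp add: matrix_mul_assoc cancel)
  also have "\<dots> = trace (snd u ** P ** snd u ** P)"
    by (subst trace_mul_sym) (simp add: cancel)
  finally show ?thesis
    using 1 by (simp add: fisher_sqnorm_def pushforward_def inv Let_def P_def[symmetric])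
qed

lemma continuous_on_fisher_form:
  assumes "continuous_on T p" "continuous_on T u" "continuous_on T v"
    and "\<And>t. t \<in> T \<Longrightarrow> invertible (snd (p t))"
  shows "continuous_on T (\<lambda>t. fisher_form (p t) (u t) (v t))"
proof -
  have P: "continuous_on T (\<lambda>t. matrix_inv (snd (p t)))"
    by (intro continuous_on_matrix_inv continuous_on_snd assms)
  show ?thesis
    unfolding fisher_form_def Let_def
    by (intro continuous_on_add continuous_on_inner continuous_on_mult continuous_on_const 
        bounded_linear.continuous_on[OF bounded_linear_trace]
        bounded_bilinear.continuous_on[OF bounded_bilinear_matrix_matrix_mult]
        bounded_bilinear.continuous_on[OF bounded_bilinear_matrix_vector_mult]
        continuous_on_fst continuous_on_snd P assms)
qed

section \<open>Rank-one affine motions and their generators\<close>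

definition id_plus_outer :: "real^'d \<Rightarrow> real^'d \<Rightarrow> real \<Rightarrow> real^'d^'d" where
  "id_plus_outer x y c = mat 1 + c *\<^sub>R outer x y"

lemma id_plus_outer_mult_vector: "id_plus_outer x y c *v z = z + (c * (y \<bullet> z)) *\<^sub>R x"
  by (simp add: id_plus_outer_def matrix_vector_mult_add_rdistrib outer_mult_vector
      scaleR_matrix_vector_assoc[symmetric])

lemma id_plus_outer_mult_outer: 
  "id_plus_outer x y c ** outer x y = (1 + c * (x \<bullet> y)) *\<^sub>R outer x y"
  unfolding matrix_mult_outer id_plus_outer_mult_vector outer_scaleR_left[symmetric]
  by (simp add: scaleR_left_distrib inner_commute)

text \<open>The inverse is given by the Sherman-Morrison formula.\<close>

lemma invertible_id_plus_outer:
  assumes "1 + c * (x \<bullet> y) \<noteq> 0"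
  shows "invertible (id_plus_outer x y c)"
proof -
  define k where "k = c / (1 + c * (x \<bullet> y))"
  have "id_plus_outer x y c ** (mat 1 - k *\<^sub>R outer x y) 
      = id_plus_outer x y c - k *\<^sub>R (id_plus_outer x y c ** outer x y)"
    using bounded_bilinear.diff_right[OF bounded_bilinear_matrix_matrix_mult]
      bounded_bilinear.scaleR_right[OF bounded_bilinear_matrix_matrix_mult]
    by (metis matrix_mul_rid)
  also have "\<dots> = mat 1 + (c - k * (1 + c * (x \<bullet> y))) *\<^sub>R outer x y"
    unfolding id_plus_outer_mult_outer by (simp add: id_plus_outer_def algebra_simps)
  also have "c - k * (1 + c * (x \<bullet> y)) = 0"
    using assms by (simp add: k_def)
  finally show ?thesis
    using invertible_right_inverse by auto
qed

text \<open>The Gaussian obtained from \<open>p\<close> by the affine map \<open>z \<mapsto> z + c (y \<bullet> z + w) x\<close> of the sample space. All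
  the maps of this form have \<open>x\<close> as the only direction of displacement: \<open>w\<close> produces the translations along \<open>x\<close>, and
  \<open>y\<close> the rank-one linear generators \<open>x y\<^sup>T\<close>, which span all matrices. Because the rank is one, the linear part has an elementary inverse.
  In the linear case this is the first-order approximation of the exponential flow, and it is
  polynomial in \<open>c\<close>.\<close>

definition affine_motion :: "real^'d \<Rightarrow> real^'d \<Rightarrow> real \<Rightarrow> real \<Rightarrow> 'd::finite gaussian \<Rightarrow> 'd gaussian" where
  "affine_motion x y w c p = (fst p + (c * (y \<bullet> fst p + w)) *\<^sub>R x,
     id_plus_outer x y c ** snd p ** transpose (id_plus_outer x y c))"

text \<open>The derivative of the affine motion at \<open>c = 0\<close>: a Killing field of the Fisher metric.\<close>

definition affine_field :: "real^'d \<Rightarrow> real^'d \<Rightarrow> real \<Rightarrow> 'd::finite gaussian \<Rightarrow> 'd gaussian" where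
  "affine_field x y w p = ((y \<bullet> fst p + w) *\<^sub>R x, outer x y ** snd p + snd p ** outer y x)"

lemma affine_motion_0 [simp]: "affine_motion x y w 0 p = p"
  by (simp add: affine_motion_def id_plus_outer_def)

lemma affine_motion_gaussian:
  assumes "p \<in> gaussians" "1 + c * (x \<bullet> y) \<noteq> 0"
  shows "affine_motion x y w c p \<in> gaussians"
  using assms pos_def_congruence[OF _ invertible_id_plus_outer[OF assms(2)]]
  by (auto simp: gaussians_def affine_motion_def)

text \<open>When the parameter \<open>c\<close> varies with time, the velocity of the moved curve is the pushforward of the old
  velocity plus a multiple of the affine field. The multiple is \<open>c' / (1 + c (x \<bullet> y))\<close> rather
  than \<open>c'\<close>, because \<open>A = 1 + c x y\<^sup>T\<close> satisfies \<open>A x = (1 + c (x \<bullet> y)) x\<close>: a factor has to be given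
  back when \<open>A\<close> is pulled out.\<close>

lemma affine_motion_has_vector_derivative:
  fixes g :: "real \<Rightarrow> 'd::finite gaussian"
  assumes g: "(g has_vector_derivative g') (at t within T)"
    and c: "(c has_real_derivative c') (at t within T)"
    and nz: "1 + c t * (x \<bullet> y) \<noteq> 0"
  shows "((\<lambda>t. affine_motion x y w (c t) (g t)) has_vector_derivative
      pushforward (id_plus_outer x y (c t)) 
        (g' + (c' / (1 + c t * (x \<bullet> y))) *\<^sub>R affine_field x y w (g t))) (at t within T)"
proof -
  define A where "A t = id_plus_outer x y (c t)" for t
  define B where "B = outer x y"
  define r where "r = c' / (1 + c t * (x \<bullet> y))"
  note cv = c[unfolded has_real_derivative_iff_has_vector_derivative]
  note g1 = bounded_linear.has_vector_derivative[OF bounded_linear_fst g]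
  note g2 = bounded_linear.has_vector_derivative[OF bounded_linear_snd g]
  have A': "(A has_vector_derivative c' *\<^sub>R B) (at t within T)"
    unfolding A_def id_plus_outer_def B_def
    using has_vector_derivative_add[OF has_vector_derivative_const
        bounded_linear.has_vector_derivative[OF bounded_linear_scaleR_left cv]] by simp
  have AB: "A t ** (r *\<^sub>R B) = c' *\<^sub>R B"
    unfolding bounded_bilinear.scaleR_right[OF bounded_bilinear_matrix_matrix_mult] A_def B_def
      id_plus_outer_mult_outer
    using nz by (simp add: r_def)
  interpret mm: bounded_bilinear "(**) :: real^'d^'d \<Rightarrow> real^'d^'d \<Rightarrow> real^'d^'d"
    by (rule bounded_bilinear_matrix_matrix_mult)
  have At: "((\<lambda>t. transpose (A t)) has_vector_derivative transpose (c' *\<^sub>R B)) (at t within T)"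
    by (rule bounded_linear.has_vector_derivative[OF bounded_linear_transpose A'])
  have "((\<lambda>t. A t ** snd (g t) ** transpose (A t)) has_vector_derivative
     A t ** snd (g t) ** transpose (c' *\<^sub>R B) + (A t ** snd g' + c' *\<^sub>R B ** snd (g t)) ** transpose (A t)) 
     (at t within T)"
    by (rule mm.has_vector_derivative mm.has_vector_derivative[OF A' g2] At)+
  moreover have "A t ** snd (g t) ** transpose (c' *\<^sub>R B) + (A t ** snd g' + c' *\<^sub>R B ** snd (g t)) ** transpose (A t)
      = A t ** (snd g' + r *\<^sub>R (B ** snd (g t) + snd (g t) ** transpose B)) ** transpose (A t)"
    unfolding AB[symmetric]
    by (simp add: mm.add_left mm.add_right matrix_transpose_mul transpose_scalar matrix_mul_assoc 
       mm.scaleR_left mm.scaleR_right scaleR_add_right)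
  ultimately have 2: "((\<lambda>t. A t ** snd (g t) ** transpose (A t)) has_vector_derivative
      A t ** (snd g' + r *\<^sub>R (B ** snd (g t) + snd (g t) ** transpose B)) ** transpose (A t)) (at t within T)"
    by simp
  have "((\<lambda>t. fst (g t) + (c t * (y \<bullet> fst (g t) + w)) *\<^sub>R x) has_vector_derivative
     fst g' + (c' * (y \<bullet> fst (g t) + w) + c t * (y \<bullet> fst g')) *\<^sub>R x) (at t within T)"
  proof -
    have "((\<lambda>t. y \<bullet> fst (g t) + w) has_real_derivative y \<bullet> fst g') (at t within T)"
      using has_vector_derivative_add[OF bounded_linear.has_vector_derivative[OF bounded_linear_inner_right g1]
        has_vector_derivative_const]
      by (simp add: has_real_derivative_iff_has_vector_derivative)
    from DERIV_mult[OF c this] show ?thesis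
      using has_vector_derivative_add[OF g1 bounded_linear.has_vector_derivative[OF bounded_linear_scaleR_left]]
      by (simp add: has_real_derivative_iff_has_vector_derivative mult.commute add.commute)
  qed
  moreover have "fst g' + (c' * (y \<bullet> fst (g t) + w) + c t * (y \<bullet> fst g')) *\<^sub>R x =
     A t *v (fst g' + r *\<^sub>R ((y \<bullet> fst (g t) + w) *\<^sub>R x))"
  proof -
    have "c' = r * (1 + c t * (x \<bullet> y))" using nz by (simp add: r_def)
    then show ?thesis
      unfolding A_def id_plus_outer_mult_vector 
      by (simp add: inner_add_right algebra_simps inner_commute)
  qed
  ultimately have 1: "((\<lambda>t. fst (g t) + (c t * (y \<bullet> fst (g t) + w)) *\<^sub>R x) has_vector_derivative
     A t *v (fst g' + r *\<^sub>R ((y \<bullet> fst (g t) + w) *\<^sub>R x))) (at t within T)"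
    by simp
  show ?thesis
    using has_vector_derivative_Pair[OF 1 2]
    by (simp add: affine_motion_def pushforward_def affine_field_def A_def B_def r_def transpose_outer)
qed

text \<open>The momenta of the affine group. The two summands of the covariance part of the field contribute
  equally to the trace, which absorbs the factor \<open>1/2\<close> of the metric; the right-hand side collects
  \<open>J\<^sub>\<mu>\<close> in the coefficient of \<open>w\<close> and \<open>J\<^sub>\<Sigma>\<close> in the bilinear form of \<open>x\<close> and \<open>y\<close>.\<close>

lemma fisher_form_affine_field:
  assumes S: "pos_def_matrix S" and V: "transpose V = V"
  shows "fisher_form (m, S) (affine_field x y w (m, S)) (u, V) =
    w * (x \<bullet> (matrix_inv S *v u)) + x \<bullet> ((matrix_inv S ** (outer u m + V)) *v y)"
proof -
  define P where "P = matrix_inv S"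
  have sym: "transpose P = P"
    unfolding P_def by (rule transpose_matrix_inv_pos_def[OF S])
  have PS: "S ** P = mat 1" "P ** S = mat 1"
    unfolding P_def by (rule matrix_inv_right_left[OF pos_def_invertible[OF S]])+
  have cancel: "X ** S ** P = X" "X ** P ** S = X" for X :: "real^'a^'a"
    using PS by (simp_all add: matrix_mul_assoc[symmetric])
  have "trace (outer x y ** S ** P ** V ** P) = trace (outer x y ** (V ** P))"
    by (simp add: matrix_mul_assoc cancel)
  also have "\<dots> = x \<bullet> ((P ** V) *v y)"
    unfolding outer_mult_matrix trace_outer matrix_transpose_mul sym V ..
  finally have 1: "trace (outer x y ** S ** P ** V ** P) = x \<bullet> ((P ** V) *v y)" .
  have "trace (S ** outer y x ** P ** V ** P) = trace (S ** (outer y x ** P ** V ** P))"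
    by (simp add: matrix_mul_assoc)
  also have "\<dots> = trace (outer y x ** (P ** V))"
    by (subst trace_mul_sym) (simp add: matrix_mul_assoc cancel)
  also have "\<dots> = y \<bullet> (transpose (P ** V) *v x)"
    unfolding outer_mult_matrix trace_outer ..
  also have "\<dots> = x \<bullet> ((P ** V) *v y)"
    unfolding inner_transpose_matrix_vector by (rule inner_commute)
  finally have 2: "trace (S ** outer y x ** P ** V ** P) = x \<bullet> ((P ** V) *v y)" .
  interpret mm: bounded_bilinear "(**) :: real^'a^'a \<Rightarrow> real^'a^'a \<Rightarrow> real^'a^'a"
    by (rule bounded_bilinear_matrix_matrix_mult)
  show ?thesis
    unfolding fisher_form_def affine_field_def Let_def P_def[symmetric] snd_conv fst_conv
    by (simp add: mm.add_left mm.add_right trace_add 1 2 matrix_mult_outer[of P] outer_mult_vector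
        matrix_vector_mult_add_rdistrib inner_add_right algebra_simps inner_commute)
qed

section \<open>First variation of the energy along affine motions\<close>

text \<open>The cutoff \<open>\<phi>\<close> fixes the endpoints, and the bound \<open>e\<close> on the deformation parameter keeps the
  linear parts invertible, hence the covariances positive definite. Smoothness
  holds because the motion is polynomial in \<open>s\<close>, \<open>\<phi>\<close> and the curve.\<close>

lemma affine_motion_variation:
  fixes g :: "real \<Rightarrow> 'd::finite gaussian"
  assumes ab: "a < b" and U: "open U" "{a..b} \<subseteq> U" and smooth: "\<And>k. Ck_on k g U"
    and gauss: "\<And>t. t \<in> {a..b} \<Longrightarrow> g t \<in> gaussians"
    and poly: "real_polynomial_function \<phi>" and \<phi>0: "\<phi> a = 0" "\<phi> b = 0"
    and e: "e > 0" "\<And>s t. \<bar>s\<bar> < e \<Longrightarrow> t \<in> {a..b} \<Longrightarrow> 1 + s * \<phi> t * (x \<bullet> y) \<noteq> 0"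
  shows "fixed_endpoint_variation a b g e (\<lambda>(s, t). affine_motion x y w (s * \<phi> t) (g t))"
proof -
  define V where "V = (snd :: real \<times> real \<Rightarrow> real) -` U"
  have V: "open V"
    unfolding V_def by (intro open_vimage U continuous_on_snd continuous_on_id)
  have g: "Ck_on k (\<lambda>z. g (snd z)) V" for k
    unfolding V_def by (rule Ck_on_compose_linear[OF bounded_linear_snd U(1) smooth])
  have p: "Ck_on k (\<lambda>z. \<phi> (snd z)) V" for k
    unfolding V_def
    by (rule Ck_on_compose_linear[OF bounded_linear_snd U(1) Ck_on_real_polynomial_function[OF poly U(1)]])
  have c: "Ck_on k (\<lambda>z. fst z * \<phi> (snd z)) V" for k
    by (intro Ck_on_bilinear[OF bounded_bilinear_mult V] p Ck_on_linear bounded_linear_fst V)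
  have A: "Ck_on k (\<lambda>z. id_plus_outer x y (fst z * \<phi> (snd z))) V" for k
    unfolding id_plus_outer_def
    by (intro Ck_on_add V Ck_on_const Ck_on_linear_compose[OF bounded_linear_scaleR_left V] c)
  have m: "Ck_on k (\<lambda>z. fst (g (snd z))) V" and S: "Ck_on k (\<lambda>z. snd (g (snd z))) V" for k
    by (rule Ck_on_linear_compose[OF bounded_linear_fst V g] Ck_on_linear_compose[OF bounded_linear_snd V g])+
  have "Ck_on k (\<lambda>z. (fst z * \<phi> (snd z)) * (y \<bullet> fst (g (snd z)) + w)) V" for k
    by (rule Ck_on_bilinear[OF bounded_bilinear_mult V c])
      (rule Ck_on_add[OF V Ck_on_linear_compose[OF bounded_linear_inner_right V m] Ck_on_const])
  then have "Ck_on k (\<lambda>z. fst (g (snd z)) + ((fst z * \<phi> (snd z)) * (y \<bullet> fst (g (snd z)) + w)) *\<^sub>R x) V" for k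
    by (rule Ck_on_add[OF V m Ck_on_linear_compose[OF bounded_linear_scaleR_left V]])
  moreover have "Ck_on k (\<lambda>z. id_plus_outer x y (fst z * \<phi> (snd z)) ** snd (g (snd z)) 
      ** transpose (id_plus_outer x y (fst z * \<phi> (snd z)))) V" for k
    by (rule Ck_on_bilinear[OF bounded_bilinear_matrix_matrix_mult V 
       Ck_on_bilinear[OF bounded_bilinear_matrix_matrix_mult V A S] 
       Ck_on_linear_compose[OF bounded_linear_transpose V A]])
  ultimately have F: "Ck_on k (\<lambda>z. affine_motion x y w (fst z * \<phi> (snd z)) (g (snd z))) V" for k
    unfolding affine_motion_def by (rule Ck_on_Pair[OF V])
  have "smooth_on ({-e<..<e} \<times> {a..b}) (\<lambda>(s, t). affine_motion x y w (s * \<phi> t) (g t))"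
    unfolding smooth_on_def
  proof (intro exI conjI)
    show "{-e<..<e} \<times> {a..b} \<subseteq> V"
      using U(2) by (auto simp: V_def)
    show "\<forall>k. Ck_on k (\<lambda>z. affine_motion x y w (fst z * \<phi> (snd z)) (g (snd z))) V"
      using F by blast
  qed (auto simp: V)
  moreover have "affine_motion x y w (s * \<phi> t) (g t) \<in> gaussians" if "s \<in> {-e<..<e}" "t \<in> {a..b}" for s t
    using that by (intro affine_motion_gaussian gauss e) auto
  ultimately show ?thesis
    using e(1) \<phi>0 by (auto simp: fixed_endpoint_variation_def)
qed

text \<open>Differentiation under the integral sign for the energy of the varied curve. At \<open>s = 0\<close> the multiplier
  \<open>r\<close> vanishes and has derivative \<open>\<phi>'\<close>, so only the cross term survives.\<close>

lemma has_real_derivative_integral_quadratic: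
  fixes f G q \<phi> \<phi>' :: "real \<Rightarrow> real"
  assumes cont: "continuous_on {a..b} f" "continuous_on {a..b} G" "continuous_on {a..b} q"
      "continuous_on {a..b} \<phi>" "continuous_on {a..b} \<phi>'"
    and e: "e > 0" "\<And>s t. \<bar>s\<bar> < e \<Longrightarrow> t \<in> {a..b} \<Longrightarrow> 1 + s * \<phi> t * \<beta> \<noteq> 0"
  defines "r \<equiv> \<lambda>s t. s * \<phi>' t / (1 + s * \<phi> t * \<beta>)"
  shows "((\<lambda>s. integral {a..b} (\<lambda>t. f t + 2 * r s t * G t + (r s t)\<^sup>2 * q t))
    has_real_derivative 2 * integral {a..b} (\<lambda>t. \<phi>' t * G t)) (at 0)"
proof -
  define D where "D s t = 1 + s * \<phi> t * \<beta>" for s t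
  define I where "I = {-e<..<e}"
  have nz: "D s t \<noteq> 0" if "s \<in> I" "t \<in> {a..b}" for s t
    using e(2)[of s t] that by (simp add: D_def I_def abs_less_iff)
  have r: "((\<lambda>s. r s t) has_real_derivative \<phi>' t / (D s t)\<^sup>2) (at s within I)"
    if "s \<in> I" "t \<in> {a..b}" for s t
  proof -
    have D': "((\<lambda>s. D s t) has_real_derivative \<phi> t * \<beta>) (at s within I)"
      unfolding D_def by (auto intro!: derivative_eq_intros)
    have "((\<lambda>s. s * \<phi>' t) has_real_derivative \<phi>' t) (at s within I)"
      by (auto intro!: derivative_eq_intros)
    from DERIV_divide[OF this D' nz[OF that]]
    have "((\<lambda>s. r s t) has_real_derivative (\<phi>' t * D s t - s * \<phi>' t * (\<phi> t * \<beta>)) / (D s t * D s t)) 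
        (at s within I)"
      by (simp add: r_def D_def)
    moreover have "\<phi>' t * D s t - s * \<phi>' t * (\<phi> t * \<beta>) = \<phi>' t"
      by (simp add: D_def algebra_simps)
    ultimately show ?thesis
      by (simp add: power2_eq_square)
  qed
  have contr: "continuous_on {a..b} (r s)" if "s \<in> I" for s
    unfolding r_def using nz[OF that] by (intro continuous_intros cont) (auto simp: D_def)
  have comp: "continuous_on (I \<times> {a..b}) (\<lambda>z. h (snd z))" if "continuous_on {a..b} h" for h :: "real \<Rightarrow> real"
    by (rule continuous_on_compose2[OF that]) (auto intro: continuous_intros)
  have contD: "continuous_on (I \<times> {a..b}) (\<lambda>z. D (fst z) (snd z))"
    unfolding D_def by (intro continuous_intros comp cont)
  have "((\<lambda>s. integral (cbox a b) (\<lambda>t. f t + 2 * r s t * G t + (r s t)\<^sup>2 * q t)) has_real_derivative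
     integral (cbox a b) (\<lambda>t. 2 * (\<phi>' t / (D 0 t)\<^sup>2) * G t + 2 * r 0 t * (\<phi>' t / (D 0 t)\<^sup>2) * q t)) (at 0 within I)"
  proof (rule leibniz_rule_field_derivative)
    show "((\<lambda>s. f t + 2 * r s t * G t + (r s t)\<^sup>2 * q t) has_real_derivative
       2 * (\<phi>' t / (D s t)\<^sup>2) * G t + 2 * r s t * (\<phi>' t / (D s t)\<^sup>2) * q t) (at s within I)"
      if "s \<in> I" "t \<in> cbox a b" for s t
      using that by (auto intro!: derivative_eq_intros r simp: mult_ac)
    show "(\<lambda>t. f t + 2 * r s t * G t + (r s t)\<^sup>2 * q t) integrable_on cbox a b" if "s \<in> I" for s
      unfolding box_real by (intro integrable_continuous_real continuous_intros cont contr that)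
    show "continuous_on (I \<times> cbox a b) (\<lambda>(s, t). 2 * (\<phi>' t / (D s t)\<^sup>2) * G t + 
        2 * r s t * (\<phi>' t / (D s t)\<^sup>2) * q t)"
      unfolding split_beta r_def D_def[symmetric] box_real 
      by (intro continuous_on_add continuous_on_mult continuous_on_divide continuous_on_power
          continuous_on_const continuous_on_fst continuous_on_id comp cont contD)
        (use nz in auto)
    show "0 \<in> I" "convex I"
      using e(1) by (auto simp: I_def)
  qed
  moreover have "r 0 t = 0" "D 0 t = 1" for t
    by (simp_all add: r_def D_def)
  moreover have "at 0 within I = at 0"
    using e(1) by (intro at_within_open) (auto simp: I_def)
  moreover have "integral {a..b} (\<lambda>t. 2 * \<phi>' t * G t) = 2 * integral {a..b} (\<lambda>t. \<phi>' t * G t)"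
    unfolding mult.assoc by (rule integral_mult_right)
  ultimately show ?thesis
    by simp
qed

text \<open>By affine invariance the energy density of the varied curve is the squared norm, at the
  \<^emph>\<open>original\<close> point, of \<open>g' + r K\<close>, where \<open>K\<close> is the affine field and \<open>r\<close> is proportional to \<open>\<phi>'\<close>. Thus the derivatives of the
  metric never enter, and the first variation is twice the integral of \<open>\<phi>'\<close> times the momentum of \<open>K\<close>.\<close>

lemma energy_critical_weak_conservation:
  fixes g :: "real \<Rightarrow> 'd::finite gaussian"
  assumes ab: "a < b" and U: "open U" "{a..b} \<subseteq> U" and smooth: "\<And>k. Ck_on k g U"
    and gauss: "\<And>t. t \<in> {a..b} \<Longrightarrow> g t \<in> gaussians"
    and crit: "energy_critical a b g"
    and g': "\<And>t. t \<in> U \<Longrightarrow> (g has_vector_derivative g' t) (at t)" "continuous_on {a..b} g'"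
    and \<phi>: "real_polynomial_function \<phi>" "real_polynomial_function \<phi>'" 
      "\<And>t. (\<phi> has_real_derivative \<phi>' t) (at t)" "\<phi> a = 0" "\<phi> b = 0"
  shows "integral {a..b} (\<lambda>t. \<phi>' t * fisher_form (g t) (affine_field x y w (g t)) (g' t)) = 0"
proof -
  define \<beta> where "\<beta> = x \<bullet> y"
  define K where "K t = affine_field x y w (g t)" for t
  have cont\<phi>: "continuous_on {a..b} \<phi>" "continuous_on {a..b} \<phi>'"
    using \<phi>(1,2) continuous_on_polymonial_function real_polynomial_function_eq by blast+
  have "bounded (\<phi> ` {a..b})"
    by (intro compact_imp_bounded compact_continuous_image cont\<phi> compact_Icc)
  then obtain M where M: "M > 0" "\<And>t. t \<in> {a..b} \<Longrightarrow> \<bar>\<phi> t\<bar> \<le> M"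
    unfolding bounded_pos by auto
  \<comment> \<open>\<open>\<bar>s\<bar> < e\<close> forces \<open>\<bar>s \<phi> \<beta>\<bar> < 1\<close>; the summand 1 covers the case \<open>\<beta> = 0\<close>.\<close>
  define e where "e = 1 / (M * (\<bar>\<beta>\<bar> + 1))"
  have e: "e > 0" using M by (simp add: e_def)
  have nz: "1 + s * \<phi> t * \<beta> \<noteq> 0" if "\<bar>s\<bar> < e" "t \<in> {a..b}" for s t
  proof -
    have "\<bar>s * \<phi> t * \<beta>\<bar> \<le> \<bar>s\<bar> * (M * (\<bar>\<beta>\<bar> + 1))"
      using M(2)[OF that(2)] M(1) by (simp add: abs_mult mult.assoc mult_left_mono mult_mono)
    also have "\<dots> < e * (M * (\<bar>\<beta>\<bar> + 1))"
      using that(1) M(1) by (intro mult_strict_right_mono) auto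
    also have "\<dots> = 1" using M(1) by (simp add: e_def)
    finally show ?thesis by linarith
  qed
  have contg: "continuous_on {a..b} g"
    using smooth[of 0] U(2) continuous_on_subset by auto
  have pd: "pos_def_matrix (snd (g t))" if "t \<in> {a..b}" for t
    using gauss[OF that] by (auto simp: gaussians_def)
  have contK: "continuous_on {a..b} K"
    unfolding K_def affine_field_def
    by (intro continuous_intros contg
      bounded_bilinear.continuous_on[OF bounded_bilinear_matrix_matrix_mult])
  note contform = continuous_on_fisher_form[OF contg _ _ pos_def_invertible[OF pd]]
  have "fixed_endpoint_variation a b g e (\<lambda>(s, t). affine_motion x y w (s * \<phi> t) (g t))"
    using nz unfolding \<beta>_def by (intro affine_motion_variation[OF ab U smooth gauss \<phi>(1,4,5) e])
  then have "((\<lambda>s. energy a b (\<lambda>t. affine_motion x y w (s * \<phi> t) (g t))) has_real_derivative 0) (at 0)"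
    using crit unfolding energy_critical_def by fastforce
  moreover define r where "r s t = s * \<phi>' t / (1 + s * \<phi> t * \<beta>)" for s t
  have en: "energy a b (\<lambda>t. affine_motion x y w (s * \<phi> t) (g t)) =
     integral {a..b} (\<lambda>t. fisher_sqnorm (g t) (g' t) + 2 * r s t * fisher_form (g t) (K t) (g' t) 
       + (r s t)\<^sup>2 * fisher_sqnorm (g t) (K t))" if "\<bar>s\<bar> < e" for s
    unfolding energy_def
  proof (rule integral_cong)
    fix t assume t: "t \<in> {a..b}"
    define A where "A = id_plus_outer x y (s * \<phi> t)"
    have nz': "1 + s * \<phi> t * (x \<bullet> y) \<noteq> 0"
      using nz[OF that t] by (simp add: \<beta>_def)
    have "((\<lambda>t. affine_motion x y w (s * \<phi> t) (g t)) has_vector_derivative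
      pushforward A (g' t + r s t *\<^sub>R K t)) (at t within {a..b})"
      unfolding A_def r_def K_def \<beta>_def
      using t U(2) nz'
      by (intro affine_motion_has_vector_derivative has_vector_derivative_at_within[OF g'(1)]
          DERIV_subset[OF DERIV_cmult[OF \<phi>(3)]]) auto
    then have "vector_derivative (\<lambda>t. affine_motion x y w (s * \<phi> t) (g t)) (at t within {a..b}) =
        pushforward A (g' t + r s t *\<^sub>R K t)"
      using vector_derivative_within_cbox[of a b t] ab t by simp
    moreover have "fisher_sqnorm (affine_motion x y w (s * \<phi> t) (g t)) (pushforward A (g' t + r s t *\<^sub>R K t))
        = fisher_sqnorm (fst (g t), snd (g t)) (g' t + r s t *\<^sub>R K t)"
      unfolding affine_motion_def A_def
      by (intro fisher_sqnorm_pushforward invertible_id_plus_outer nz' pos_def_invertible pd t)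
    ultimately show "fisher_sqnorm (affine_motion x y w (s * \<phi> t) (g t))
         (vector_derivative (\<lambda>t. affine_motion x y w (s * \<phi> t) (g t)) (at t within {a..b})) =
        fisher_sqnorm (g t) (g' t) + 2 * r s t * fisher_form (g t) (K t) (g' t) 
       + (r s t)\<^sup>2 * fisher_sqnorm (g t) (K t)"
      by (simp add: fisher_sqnorm_add_scaleR[OF pd[OF t]])
  qed
  have "((\<lambda>s. integral {a..b} (\<lambda>t. fisher_sqnorm (g t) (g' t) + 2 * r s t * fisher_form (g t) (K t) (g' t) 
       + (r s t)\<^sup>2 * fisher_sqnorm (g t) (K t))) has_real_derivative 
      2 * integral {a..b} (\<lambda>t. \<phi>' t * fisher_form (g t) (K t) (g' t))) (at 0)"
    unfolding r_def fisher_sqnorm_eq_form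
    by (rule has_real_derivative_integral_quadratic[OF _ _ _ cont\<phi> e nz]) 
      (intro contform contK g'(2); assumption)+
  then have "((\<lambda>s. energy a b (\<lambda>t. affine_motion x y w (s * \<phi> t) (g t))) has_real_derivative 
      2 * integral {a..b} (\<lambda>t. \<phi>' t * fisher_form (g t) (K t) (g' t))) (at 0)"
  proof (rule has_field_derivative_transform_within_open)
    show "0 \<in> {-e<..<e}" using e by simp
  qed (use e in \<open>auto simp: en abs_less_iff\<close>)
  ultimately have "0 = 2 * integral {a..b} (\<lambda>t. \<phi>' t * fisher_form (g t) (K t) (g' t))"
    by (rule DERIV_unique)
  then show ?thesis
    by (simp add: K_def)
qed

lemma energy_critical_conservation:
  fixes g :: "real \<Rightarrow> 'd::finite gaussian"
  assumes ab: "a < b" and U: "open U" "{a..b} \<subseteq> U" and smooth: "\<And>k. Ck_on k g U"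
    and gauss: "\<And>t. t \<in> {a..b} \<Longrightarrow> g t \<in> gaussians"
    and crit: "energy_critical a b g"
    and g': "\<And>t. t \<in> U \<Longrightarrow> (g has_vector_derivative g' t) (at t)" "continuous_on {a..b} g'"
  shows "fisher_form (g a) (affine_field x y w (g a)) (g' a) = 
    fisher_form (g b) (affine_field x y w (g b)) (g' b)"
proof (rule du_Bois_Reymond_polynomial[OF ab])
  have contg: "continuous_on {a..b} g"
    using smooth[of 0] U(2) continuous_on_subset by auto
  have "continuous_on {a..b} (\<lambda>t. affine_field x y w (g t))"
    unfolding affine_field_def
    by (intro continuous_intros contg
      bounded_bilinear.continuous_on[OF bounded_bilinear_matrix_matrix_mult])
  moreover have "invertible (snd (g t))" if "t \<in> {a..b}" for t
    using gauss[OF that] pos_def_invertible by (auto simp: gaussians_def)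
  ultimately show "continuous_on {a..b} (\<lambda>t. fisher_form (g t) (affine_field x y w (g t)) (g' t))"
    by (intro continuous_on_fisher_form contg g'(2))
qed (rule energy_critical_weak_conservation[OF assms])

section \<open>Conservation along geodesics\<close>

text \<open>Velocities of covariances are symmetric, as the momentum formula requires.\<close>

lemma symmetric_matrix_has_vector_derivative:
  fixes S :: "real \<Rightarrow> real^'d^'d"
  assumes "a < b" "t \<in> {a..b}" "(S has_vector_derivative S') (at t within {a..b})"
    and sym: "\<And>t. t \<in> {a..b} \<Longrightarrow> transpose (S t) = S t"
  shows "transpose S' = S'"
proof -
  have "((\<lambda>t. transpose (S t)) has_vector_derivative transpose S') (at t within {a..b})"
    by (rule bounded_linear.has_vector_derivative[OF bounded_linear_transpose assms(3)])
  then have "(S has_vector_derivative transpose S') (at t within {a..b})"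
    by (rule has_vector_derivative_transform[OF assms(2), rotated]) (simp add: sym)
  then show ?thesis
    using vector_derivative_unique_within_closed_interval[OF assms(1), of t S "transpose S'" S']
      assms(2,3) by simp
qed

text \<open>The conserved momenta determine both quantities: \<open>w = 1, y = 0\<close> isolates \<open>x \<bullet> J\<^sub>\<mu>\<close>, and \<open>w = 0\<close>
  isolates \<open>x \<bullet> J\<^sub>\<Sigma> y\<close>. A smooth extension \<open>g\<close> of the curve supplies two-sided derivatives, so the
  one-sided derivatives in \<open>[a, b]\<close> and in \<open>I\<close> agree even at endpoints.\<close>

lemma geodesic_J_eq:
  fixes \<mu> :: "real \<Rightarrow> real ^ 'd" and \<Sigma> :: "real \<Rightarrow> real ^ 'd ^ 'd"
  assumes geo: "geodesic_on I (\<lambda>t. (\<mu> t, \<Sigma> t))" and ab: "a < b" "a \<in> I" "b \<in> I"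
  shows "J_mu I \<mu> \<Sigma> a = J_mu I \<mu> \<Sigma> b" and "J_Sigma I \<mu> \<Sigma> a = J_Sigma I \<mu> \<Sigma> b"
proof -
  define c where "c = (\<lambda>t. (\<mu> t, \<Sigma> t))"
  have I: "is_interval I" and sm: "smooth_on I c" and cI: "c ` I \<subseteq> gaussians"
    and crit: "\<And>a b. a < b \<Longrightarrow> {a..b} \<subseteq> I \<Longrightarrow> energy_critical a b c"
    using geo unfolding c_def[symmetric] geodesic_on_def by blast+
  have abI: "{a..b} \<subseteq> I"
    using mem_is_interval_1_I[OF I ab(2,3)] by auto
  obtain U g where U: "open U" "I \<subseteq> U" and g: "\<And>k. Ck_on k g U" and gc: "\<And>t. t \<in> I \<Longrightarrow> g t = c t"
    using sm unfolding smooth_on_def by blast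
  obtain g' where g': "\<And>t. t \<in> U \<Longrightarrow> (g has_vector_derivative g' t) (at t)" and g0: "Ck_on 0 g' U"
    using Ck_on_Suc_vector_derivative[OF g U(1)] by blast
  have cont': "continuous_on {a..b} g'"
    by (rule continuous_on_subset[of U]) (use g0 abI U(2) in auto)
  have abU: "{a..b} \<subseteq> U" using abI U(2) by blast
  have gauss: "g t \<in> gaussians" if "t \<in> {a..b}" for t
  proof -
    have "t \<in> I" using abI that by blast
    then show ?thesis using cI gc[of t] by auto
  qed
  \<comment> \<open>Criticality passes from \<open>c\<close> to \<open>g\<close>: a variation involves only the values on \<open>[a, b]\<close>.\<close>
  have "fixed_endpoint_variation a b c e F" if "fixed_endpoint_variation a b g e F" for e F
  proof -
    have eq: "g t = c t" if "t \<in> {a..b}" for t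
      using abI that by (intro gc) blast
    show ?thesis
      using that ab(1) unfolding fixed_endpoint_variation_def by (simp add: eq)
  qed
  then have critg: "energy_critical a b g"
    using crit[OF ab(1) abI] unfolding energy_critical_def by blast
  have D: "(c has_vector_derivative g' t) (at t within I)" if "t \<in> I" for t
    by (rule has_vector_derivative_transform[OF that _ has_vector_derivative_at_within[OF g']])
      (use that U gc in auto)
  have nontriv: "at t within I \<noteq> bot" if "t \<in> {a..b}" for t
  proof -
    have "at t within {a..b} \<noteq> bot"
      using ab(1) that by (simp add: trivial_limit_within islimpt_Icc)
    moreover have "at t within {a..b} \<le> at t within I"
      by (rule at_le[OF abI])
    ultimately show ?thesis using le_bot[of "at t within {a..b}"] by auto
  qed
  have tI: "t \<in> I" if "t \<in> {a..b}" for t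
    using abI that by blast
  have D\<mu>: "(\<mu> has_vector_derivative fst (g' t)) (at t within I)"
    and D\<Sigma>: "(\<Sigma> has_vector_derivative snd (g' t)) (at t within I)" if "t \<in> {a..b}" for t
    using bounded_linear.has_vector_derivative[OF bounded_linear_fst D[OF tI[OF that]]]
      bounded_linear.has_vector_derivative[OF bounded_linear_snd D[OF tI[OF that]]]
    by (simp_all add: c_def)
  note vd = vector_derivative_within[OF nontriv D\<mu>] vector_derivative_within[OF nontriv D\<Sigma>]
  have pd: "pos_def_matrix (\<Sigma> t)" if "t \<in> {a..b}" for t
    using cI tI[OF that] by (auto simp: gaussians_def c_def)
  have sym: "transpose (snd (g' t)) = snd (g' t)" if "t \<in> {a..b}" for t
  proof (rule symmetric_matrix_has_vector_derivative[OF ab(1) that])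
    show "(\<Sigma> has_vector_derivative snd (g' t)) (at t within {a..b})"
      by (rule has_vector_derivative_within_subset[OF D\<Sigma>[OF that] abI])
    show "transpose (\<Sigma> t) = \<Sigma> t" if "t \<in> {a..b}" for t
      using pd[OF that] unfolding pos_def_matrix_def by blast
  qed
  have form: "fisher_form (g t) (affine_field x y w (g t)) (g' t) =
    w * (x \<bullet> J_mu I \<mu> \<Sigma> t) + x \<bullet> (J_Sigma I \<mu> \<Sigma> t *v y)" if "t \<in> {a..b}" for x y w t
    using fisher_form_affine_field[OF pd[OF that] sym[OF that], of "\<mu> t" x y w "fst (g' t)"]
    by (simp add: J_mu_def J_Sigma_def vd[OF that that] gc[OF tI[OF that]] c_def)
  have cons: "w * (x \<bullet> J_mu I \<mu> \<Sigma> a) + x \<bullet> (J_Sigma I \<mu> \<Sigma> a *v y) =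
     w * (x \<bullet> J_mu I \<mu> \<Sigma> b) + x \<bullet> (J_Sigma I \<mu> \<Sigma> b *v y)" for x y w
    using energy_critical_conservation[OF ab(1) U(1) abU g gauss critg g' cont', of x y w] ab(1)
    by (simp add: form)
  show "J_mu I \<mu> \<Sigma> a = J_mu I \<mu> \<Sigma> b"
    using cons[of 1 _ 0] vector_eq_ldot[of "J_mu I \<mu> \<Sigma> a" "J_mu I \<mu> \<Sigma> b"] by simp
  have "J_Sigma I \<mu> \<Sigma> a *v y = J_Sigma I \<mu> \<Sigma> b *v y" for y
    using cons[of 0 _ y] vector_eq_ldot[of "J_Sigma I \<mu> \<Sigma> a *v y" "J_Sigma I \<mu> \<Sigma> b *v y"] 
    by simp
  then show "J_Sigma I \<mu> \<Sigma> a = J_Sigma I \<mu> \<Sigma> b"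
    by (simp add: matrix_eq)
qed

theorem theorem18:
  fixes \<mu> :: "real \<Rightarrow> real ^ 'd"
    and \<Sigma> :: "real \<Rightarrow> real ^ 'd ^ 'd"
    and I :: "real set"
  assumes "geodesic_on I (\<lambda>t. (\<mu> t, \<Sigma> t))"
  shows "J_mu I \<mu> \<Sigma> constant_on I \<and> J_Sigma I \<mu> \<Sigma> constant_on I"
proof -
  have "J_mu I \<mu> \<Sigma> s = J_mu I \<mu> \<Sigma> t \<and> J_Sigma I \<mu> \<Sigma> s = J_Sigma I \<mu> \<Sigma> t" if "s \<in> I" "t \<in> I" for s t
  proof (cases s t rule: linorder_cases)
    case less
    show ?thesis by (intro conjI geodesic_J_eq[OF assms less that])
  next
    case greater
    show ?thesis by (intro conjI geodesic_J_eq[OF assms greater that(2,1), symmetric])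
  qed simp
  then show ?thesis
    unfolding constant_on_def by blast
qed

end
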